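(* Let $n,m\ge1$ and let $F:\mathbb{R}^{n\times m}\to\mathbb{S}^n$, $F(X)=\frac12XX^T$. Then the following hold: (a) $\hat K_F=K_F=\mathbb{S}^n_+=\mathrm{conv}(\mathrm{rge}\,F)$; in the case $m=n$ the convex hull is superfluous, i.e. $\mathbb{S}^n_+=\mathrm{rge}\,F$. (b) $F$ is $\mathbb{S}^n_+$-closed and $\mathbb{S}^n_+$-convex. (c) $\overline{\mathrm{conv}}(\mathrm{gph}\,F)=\mathbb{S}^n_+\text{-}\mathrm{epi}\,F$.
   Context: $\mathbb{S}^n$ is the space of real symmetric $n\times n$ matrices, $\mathbb{S}^n_+$ the cone of positive semidefinite ones; matrix spaces carry the inner product $\langle X,Y\rangle=\mathrm{tr}(X^TY)$. For a map $F:D\subset\mathbb{E}_1\to\mathbb{E}_2$ between Euclidean spaces with $D$ nonempty and convex and a cone $K\subset\mathbb{E}_2$ (a nonempty set closed under multiplication by all $\lambda\ge0$), $K\text{-}\mathrm{epi}\,F:=\{(x,y)\in D\times\mathbb{E}_2 : y-F(x)\in K\}$; $F$ is $K$-convex if this set is convex and $K$-closed if it is closed in $\mathbb{E}_1\times\mathbb{E}_2$. $K_F$ is the smallest closed convex cone $K$ such that $F$ is $K$-convex (it always exists). $\hat K_F$ is the smallest closed convex cone $K$ such that $F$ is $K$-convex and $K$-closed (if it exists; statement (a) includes its existence). "Smallest" means contained in every other such closed convex cone. $\mathrm{rge}\,F$ is the range, $\mathrm{gph}\,F$ the graph, $\overline{\mathrm{conv}}$ the closed convex hull. *)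

theory Defs
  imports "HOL-Analysis.Analysis"
begin

text \<open>
  A map \<open>F : D \<subseteq> E1 \<rightarrow> E2\<close> between Euclidean spaces is given by its domain \<open>D\<close>, its target space
  \<open>E\<close> and an ambient function \<open>F\<close>. Here \<open>E\<close> is a linear subspace of a type of class
  \<open>euclidean_space\<close>, with the induced inner product, so that the target may be the space of
  symmetric matrices. Closedness is always relative to \<open>E\<close> or to \<open>UNIV \<times> E\<close>. As \<open>E\<close> is
  closed, this coincides with closedness in the ambient type, and the closure of a subset of
  \<open>UNIV \<times> E\<close> is its closure in \<open>UNIV \<times> E\<close>.
\<close>

definition closed_convex_cone :: "'b::euclidean_space set \<Rightarrow> 'b set \<Rightarrow> bool" where
  "closed_convex_cone E K \<longleftrightarrow> K \<noteq> {} \<and> cone K \<and> convex K \<and> closedin (top_of_set E) K"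

definition K_epi ::
  "'a::euclidean_space set \<Rightarrow> 'b::euclidean_space set \<Rightarrow> ('a \<Rightarrow> 'b) \<Rightarrow> 'b set \<Rightarrow> ('a \<times> 'b) set" where
  "K_epi D E F K = {(x, y). x \<in> D \<and> y \<in> E \<and> y - F x \<in> K}"

definition K_convex ::
  "'a::euclidean_space set \<Rightarrow> 'b::euclidean_space set \<Rightarrow> ('a \<Rightarrow> 'b) \<Rightarrow> 'b set \<Rightarrow> bool" where
  "K_convex D E F K \<longleftrightarrow> convex (K_epi D E F K)"

definition K_closed ::
  "'a::euclidean_space set \<Rightarrow> 'b::euclidean_space set \<Rightarrow> ('a \<Rightarrow> 'b) \<Rightarrow> 'b set \<Rightarrow> bool" where
  "K_closed D E F K \<longleftrightarrow> closedin (top_of_set (UNIV \<times> E)) (K_epi D E F K)"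

definition is_smallest :: "('b set \<Rightarrow> bool) \<Rightarrow> 'b set \<Rightarrow> bool" where
  "is_smallest P K \<longleftrightarrow> P K \<and> (\<forall>K'. P K' \<longrightarrow> K \<subseteq> K')"

definition is_K_F ::
  "'a::euclidean_space set \<Rightarrow> 'b::euclidean_space set \<Rightarrow> ('a \<Rightarrow> 'b) \<Rightarrow> 'b set \<Rightarrow> bool" where
  "is_K_F D E F = is_smallest (\<lambda>K. closed_convex_cone E K \<and> K_convex D E F K)"

definition is_K_F_hat ::
  "'a::euclidean_space set \<Rightarrow> 'b::euclidean_space set \<Rightarrow> ('a \<Rightarrow> 'b) \<Rightarrow> 'b set \<Rightarrow> bool" where
  "is_K_F_hat D E F =
     is_smallest (\<lambda>K. closed_convex_cone E K \<and> K_convex D E F K \<and> K_closed D E F K)"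

text \<open>
  The next two constants are specified only if the respective smallest cone exists. For
  \<open>K_F\<close> it always does (lemma \<open>is_K_F_K_F\<close> below).
\<close>

definition K_F ::
  "'a::euclidean_space set \<Rightarrow> 'b::euclidean_space set \<Rightarrow> ('a \<Rightarrow> 'b) \<Rightarrow> 'b set" where
  "K_F D E F = (THE K. is_K_F D E F K)"

definition K_F_hat ::
  "'a::euclidean_space set \<Rightarrow> 'b::euclidean_space set \<Rightarrow> ('a \<Rightarrow> 'b) \<Rightarrow> 'b set" where
  "K_F_hat D E F = (THE K. is_K_F_hat D E F K)"

definition gph :: "'a set \<Rightarrow> ('a \<Rightarrow> 'b) \<Rightarrow> ('a \<times> 'b) set" where
  "gph D F = (\<lambda>x. (x, F x)) ` D"

definition sym_mats :: "(real ^ 'n ^ 'n) set" where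
  "sym_mats = {A. transpose A = A}"

definition psd_mats :: "(real ^ 'n ^ 'n) set" where
  "psd_mats = {A \<in> sym_mats. \<forall>x. 0 \<le> x \<bullet> (A *v x)}"

lemma is_smallest_unique: "is_smallest P K \<Longrightarrow> is_smallest P L \<Longrightarrow> K = L"
  unfolding is_smallest_def by blast

lemma K_F_eqI: "is_K_F D E F K \<Longrightarrow> K_F D E F = K"
  unfolding K_F_def is_K_F_def by (rule the_equality) (assumption, erule (1) is_smallest_unique)

lemma K_F_hat_eqI: "is_K_F_hat D E F K \<Longrightarrow> K_F_hat D E F = K"
  unfolding K_F_hat_def is_K_F_hat_def by (rule the_equality) (assumption, erule (1) is_smallest_unique)

lemma is_K_F_K_F:
  fixes F :: "'a::euclidean_space \<Rightarrow> 'b::euclidean_space"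
  assumes E: "subspace E" and D: "convex D" and F: "F ` D \<subseteq> E"
  shows "is_K_F D E F (K_F D E F)"
proof -
  let ?P = "\<lambda>K. closed_convex_cone E K \<and> K_convex D E F K"
  let ?K = "\<Inter> (Collect ?P)"
  have "K_epi D E F E = D \<times> E"
    using F subspace_diff[OF E] by (fastforce simp: K_epi_def)
  then have "?P E"
    using E D subspace_0[OF E]
    by (auto simp: closed_convex_cone_def K_convex_def subspace_imp_convex cone_def
        subspace_scale convex_Times)
  then have ne: "Collect ?P \<noteq> {}" by blast
  have zero: "0 \<in> K" if "?P K" for K
    using that by (metis closed_convex_cone_def cone_contains_0)
  have "K_epi D E F ?K = \<Inter> (K_epi D E F ` Collect ?P)"
    using ne by (auto simp: K_epi_def)
  moreover have "convex (\<Inter> (K_epi D E F ` Collect ?P))"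
    by (rule convex_Inter) (auto simp: K_convex_def)
  ultimately have "K_convex D E F ?K"
    unfolding K_convex_def by (simp only:)
  moreover have "closed_convex_cone E ?K"
  proof (rule closed_convex_cone_def[THEN iffD2], intro conjI)
    show "?K \<noteq> {}" using zero by blast
    show "cone ?K" by (auto simp: cone_def closed_convex_cone_def)
    show "convex ?K" by (rule convex_Inter) (auto simp: closed_convex_cone_def)
    show "closedin (top_of_set E) ?K"
      by (rule closedin_Inter[OF ne]) (auto simp: closed_convex_cone_def)
  qed
  ultimately have "is_K_F D E F ?K"
    unfolding is_K_F_def is_smallest_def by blast
  then show ?thesis using K_F_eqI by metis
qed

lemma subspace_sym_mats: "subspace sym_mats"
  by (auto simp: subspace_def sym_mats_def transpose_def vec_eq_iff)

end

theory Submission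
  imports Defs
begin

text \<open>
  The map \<open>X \<mapsto> X X\<^sup>T / 2\<close> is a matrix-valued square, and everything follows from two facts.

  The first is that the positive semidefinite matrices are exactly the sums of rank-one matrices
  \<open>v v\<^sup>T\<close> (\<open>psd_as_sum_of_outer\<close>). Eliminating one index after the other by Schur complements
  shows that \<open>n\<close> such terms suffice. As a matrix with columns \<open>\<surd>2 v\<^sub>j\<close> has half Gram matrix
  \<open>\<Sum>\<^sub>j v\<^sub>j v\<^sub>j\<^sup>T\<close>, a single matrix does it if \<open>m = n\<close>; for other \<open>m\<close> each rank-one term lies in
  the range, which is closed under scaling, so the sum is a convex combination of range points.

  The second is the exact convexity defect
  \<open>u F(X) + v F(Y) - F(u X + v Y) = u v F(X - Y)\<close> for \<open>u + v = 1\<close>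
  (\<open>half_gram_convex_comb\<close>). The defect is positive semidefinite, so \<open>F\<close> is convex with
  respect to that cone. Conversely, at the midpoint of \<open>X + Z\<close> and \<open>X - Z\<close> the defect is
  \<open>F(Z)\<close>. With \<open>X = 0\<close> this forces every closed convex cone for which \<open>F\<close> is convex to
  contain the range of \<open>F\<close>, hence its convex hull, which gives minimality. With general \<open>X\<close> it
  shows that the convex hull of the graph contains \<open>(X, F(X) + F(Z))\<close>, hence \<open>(X, F(X) + P)\<close> for every positive
  semidefinite \<open>P\<close>; thus the convex hull of the graph already equals the epigraph and is
  closed, because the epigraph is.
\<close>

section \<open>The cone of positive semidefinite matrices\<close>

lemma sym_mats_nth: "A \<in> sym_mats \<Longrightarrow> A $ i $ j = A $ j $ i"
  by (metis (mono_tags, lifting) mem_Collect_eq sym_mats_def transpose_def vec_lambda_beta)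

lemma sym_mats_inner_commute:
  fixes A :: "real ^ 'n ^ 'n"
  assumes "A \<in> sym_mats"
  shows "x \<bullet> (A *v y) = y \<bullet> (A *v x)"
  using assms dot_lmul_matrix[of x A y] transpose_matrix_vector[of A x]
  by (simp add: sym_mats_def inner_commute)

lemma psd_matsI:
  "A \<in> sym_mats \<Longrightarrow> (\<And>x. 0 \<le> x \<bullet> (A *v x)) \<Longrightarrow> A \<in> psd_mats"
  by (simp add: psd_mats_def)

lemma psd_mats_sym: "A \<in> psd_mats \<Longrightarrow> A \<in> sym_mats"
  by (simp add: psd_mats_def)

lemma psd_mats_nonneg: "A \<in> psd_mats \<Longrightarrow> 0 \<le> x \<bullet> (A *v x)"
  by (simp add: psd_mats_def)

lemma psd_mats_add:
  assumes "A \<in> psd_mats" "B \<in> psd_mats"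
  shows "A + B \<in> psd_mats"
  using assms subspace_add[OF subspace_sym_mats]
  by (intro psd_matsI)
    (auto dest: psd_mats_sym simp: matrix_vector_mult_add_rdistrib inner_add_right psd_mats_nonneg)

lemma psd_mats_scaleR:
  assumes "A \<in> psd_mats" "0 \<le> c"
  shows "c *\<^sub>R A \<in> psd_mats"
  using assms subspace_scale[OF subspace_sym_mats]
  by (intro psd_matsI)
    (auto dest: psd_mats_sym simp: scaleR_matrix_vector_assoc[symmetric] psd_mats_nonneg)

lemma zero_mem_psd_mats: "0 \<in> psd_mats"
  using subspace_0[OF subspace_sym_mats] by (auto intro!: psd_matsI)

lemma closed_psd_mats: "closed (psd_mats :: (real ^ 'n ^ 'n) set)"
proof -
  have eq: "psd_mats = sym_mats \<inter> (\<Inter>x. {A :: real ^ 'n ^ 'n. 0 \<le> x \<bullet> (A *v x)})"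
    by (auto simp: psd_mats_def)
  have "closed {A :: real ^ 'n ^ 'n. 0 \<le> x \<bullet> (A *v x)}" for x
    by (intro closed_Collect_le continuous_intros)
      (simp add: matrix_vector_mult_def, intro continuous_intros)
  then show ?thesis
    unfolding eq by (intro closed_Int closed_subspace[OF subspace_sym_mats] closed_INT ballI)
qed

lemma closed_convex_cone_psd_mats: "closed_convex_cone sym_mats psd_mats"
  unfolding closed_convex_cone_def
proof (intro conjI)
  show "psd_mats \<noteq> {}" using zero_mem_psd_mats by blast
  show "cone psd_mats" by (simp add: cone_def psd_mats_scaleR)
  show "convex psd_mats" by (simp add: convex_def psd_mats_add psd_mats_scaleR)
  show "closedin (top_of_set sym_mats) psd_mats"
    using closed_psd_mats psd_mats_sym by (intro closed_subset) auto
qed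


section \<open>Decomposition into rank-one matrices\<close>

definition outer :: "real ^ 'n \<Rightarrow> real ^ 'n ^ 'n" where
  "outer v = (\<chi> i j. v $ i * v $ j)"

lemma outer_nth [simp]: "outer v $ i $ j = v $ i * v $ j"
  by (simp add: outer_def)

lemma outer_sym: "outer v \<in> sym_mats"
  by (simp add: sym_mats_def transpose_def vec_eq_iff mult.commute)

lemma outer_mult_vec: "outer v *v x = (v \<bullet> x) *\<^sub>R v"
  by (simp add: vec_eq_iff matrix_vector_mult_def inner_vec_def sum_distrib_left ac_simps)

lemma outer_scaleR: "outer (c *\<^sub>R v) = c\<^sup>2 *\<^sub>R outer v"
  by (simp add: vec_eq_iff power2_eq_square)

lemma axis_inner_mult_vec: "axis k (1 :: real) \<bullet> (A *v y) = (A $ k) \<bullet> y"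
  by (simp add: inner_axis' matrix_vector_mul_component)

text \<open>
  If the diagonal entry vanishes, the quadratic form along \<open>t e\<^sub>k + e\<^sub>j\<close> is affine in \<open>t\<close> with
  slope \<open>2 A\<^sub>k\<^sub>j\<close>, and a nonconstant affine function takes negative values.
\<close>

lemma psd_mats_zero_diag_imp_zero_row:
  fixes A :: "real ^ 'n ^ 'n"
  assumes A: "A \<in> psd_mats" and 0: "A $ k $ k = 0"
  shows "A $ k = 0"
proof -
  have "A $ k $ j = 0" for j
  proof (rule ccontr)
    assume nz: "A $ k $ j \<noteq> 0"
    define t where "t = - (A $ j $ j + 1) / (2 * A $ k $ j)"
    let ?x = "t *\<^sub>R axis k 1 + axis j 1 :: real ^ 'n"
    have "?x \<bullet> (A *v ?x) = 2 * t * A $ k $ j + A $ j $ j"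
      using 0 sym_mats_nth[OF psd_mats_sym[OF A], of j k]
      by (simp add: inner_add_left inner_scaleR_left axis_inner_mult_vec inner_add_right
          inner_scaleR_right inner_axis)
    also have "\<dots> = -1"
      using nz by (simp add: t_def field_simps)
    finally show False
      using psd_mats_nonneg[OF A, of ?x] by simp
  qed
  then show ?thesis by (simp add: vec_eq_iff)
qed

text \<open>
  The Schur complement takes at \<open>x\<close> the value that \<open>A\<close> takes at
  \<open>y = x - ((a \<bullet> x) / \<alpha>) e\<^sub>k\<close>, where \<open>a\<close> is the \<open>k\<close>-th row and \<open>\<alpha>\<close> its diagonal entry;
  this \<open>y\<close> minimises the form of \<open>A\<close> on the line through \<open>x\<close> in direction \<open>e\<^sub>k\<close>.
\<close>

lemma psd_mats_schur_complement:
  fixes A :: "real ^ 'n ^ 'n"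
  assumes A: "A \<in> psd_mats" and pos: "0 < A $ k $ k"
  shows "A - (1 / A $ k $ k) *\<^sub>R outer (A $ k) \<in> psd_mats"
proof (rule psd_matsI)
  show "A - (1 / A $ k $ k) *\<^sub>R outer (A $ k) \<in> sym_mats"
    by (intro subspace_diff[OF subspace_sym_mats] subspace_scale[OF subspace_sym_mats]
        outer_sym psd_mats_sym[OF A])
next
  fix x :: "real ^ 'n"
  let ?\<alpha> = "A $ k $ k" and ?s = "A $ k \<bullet> x"
  let ?y = "x - (?s / ?\<alpha>) *\<^sub>R axis k 1"
  have "x \<bullet> (A *v axis k 1) = ?s"
    by (metis sym_mats_inner_commute[OF psd_mats_sym[OF A]] axis_inner_mult_vec)
  then have "?y \<bullet> (A *v ?y) = x \<bullet> (A *v x) - ?s\<^sup>2 / ?\<alpha>"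
    using pos
    by (simp add: matrix_vector_mult_diff_distrib matrix_vector_mult_scaleR inner_diff_left
        inner_diff_right axis_inner_mult_vec inner_axis field_simps power2_eq_square)
  also have "\<dots> = x \<bullet> ((A - (1 / ?\<alpha>) *\<^sub>R outer (A $ k)) *v x)"
    by (simp add: matrix_vector_mult_diff_rdistrib scaleR_matrix_vector_assoc[symmetric]
        outer_mult_vec inner_diff_right inner_commute power2_eq_square)
  finally show "0 \<le> x \<bullet> ((A - (1 / ?\<alpha>) *\<^sub>R outer (A $ k)) *v x)"
    using psd_mats_nonneg[OF A, of ?y] by simp
qed

text \<open>
  Eliminating an index clears its row and column and creates no new nonzero rows, so the set of
  indices that carry the matrix shrinks by one with each rank-one term that is split off.
\<close>

lemma psd_as_sum_of_outer_on:
  fixes A :: "real ^ 'n ^ 'n"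
  assumes "finite S" "A \<in> psd_mats" "\<And>i. i \<notin> S \<Longrightarrow> A $ i = 0"
  shows "\<exists>v. A = (\<Sum>k\<in>S. outer (v k))"
  using assms
proof (induction S arbitrary: A rule: finite_induct)
  case empty
  then show ?case by (simp add: vec_eq_iff)
next
  case (insert k S)
  note A = insert.prems(1)
  have "0 \<le> A $ k $ k"
    using psd_mats_nonneg[OF A, of "axis k 1"] by (simp add: axis_inner_mult_vec inner_axis)
  then consider "A $ k $ k = 0" | "0 < A $ k $ k" by linarith
  then obtain w where B: "A - outer w \<in> psd_mats"
    and rows: "\<And>i. i \<notin> S \<Longrightarrow> (A - outer w) $ i = 0"
  proof cases
    case 1
    have "(outer 0 :: real ^ 'n ^ 'n) = 0" by (simp add: vec_eq_iff)
    moreover have "A $ i = 0" if "i \<notin> S" for i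
      using that psd_mats_zero_diag_imp_zero_row[OF A 1] insert.prems(2) by (cases "i = k") auto
    ultimately show ?thesis using A by (intro that[of 0]) simp_all
  next
    case 2
    let ?w = "(1 / sqrt (A $ k $ k)) *\<^sub>R (A $ k)"
    have w: "outer ?w = (1 / A $ k $ k) *\<^sub>R outer (A $ k)"
      using 2 by (simp add: outer_scaleR power_divide)
    show ?thesis
    proof (rule that[of ?w])
      show "A - outer ?w \<in> psd_mats"
        unfolding w by (rule psd_mats_schur_complement[OF A 2])
      fix i assume "i \<notin> S"
      show "(A - outer ?w) $ i = 0"
      proof (cases "i = k")
        case True
        then show ?thesis using 2 unfolding w by (simp add: vec_eq_iff)
      next
        case False
        then have "A $ i = 0" using \<open>i \<notin> S\<close> insert.prems(2) by blast
        moreover from this have "A $ k $ i = 0"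
          using sym_mats_nth[OF psd_mats_sym[OF A], of k i] by simp
        ultimately show ?thesis unfolding w by (simp add: vec_eq_iff)
      qed
    qed
  qed
  from insert.IH[OF B rows] obtain v where v: "A - outer w = (\<Sum>j\<in>S. outer (v j))" by blast
  have "(\<Sum>j\<in>insert k S. outer ((v(k := w)) j)) = outer w + (\<Sum>j\<in>S. outer ((v(k := w)) j))"
    using insert.hyps by simp
  also have "(\<Sum>j\<in>S. outer ((v(k := w)) j)) = (\<Sum>j\<in>S. outer (v j))"
    using insert.hyps by (intro sum.cong) auto
  also have "outer w + \<dots> = A" using v by (simp add: algebra_simps)
  finally show ?case by metis
qed

corollary psd_as_sum_of_outer:
  fixes A :: "real ^ 'n ^ 'n"
  assumes "A \<in> psd_mats"
  obtains v :: "'n \<Rightarrow> real ^ 'n" where "A = (\<Sum>k\<in>UNIV. outer (v k))"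
  using psd_as_sum_of_outer_on[of UNIV A] assms by auto


section \<open>The half Gram map and its range\<close>

definition half_gram :: "real ^ 'm ^ 'n \<Rightarrow> real ^ 'n ^ 'n" where
  "half_gram X = (1 / 2) *\<^sub>R (X ** transpose X)"

lemma half_gram_nth: "half_gram X $ i $ j = (X $ i \<bullet> X $ j) / 2"
  by (simp add: half_gram_def matrix_matrix_mult_def transpose_def inner_vec_def)

lemma half_gram_0 [simp]: "half_gram 0 = 0"
  by (simp add: vec_eq_iff half_gram_nth)

lemma half_gram_minus [simp]: "half_gram (- X) = half_gram X"
  by (simp add: vec_eq_iff half_gram_nth)

lemma half_gram_scaleR: "half_gram (c *\<^sub>R X) = c\<^sup>2 *\<^sub>R half_gram X"
  by (simp add: vec_eq_iff half_gram_nth power2_eq_square)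

lemma half_gram_psd: "half_gram X \<in> psd_mats"
proof (rule psd_matsI)
  show "half_gram X \<in> sym_mats"
    by (simp add: sym_mats_def transpose_def vec_eq_iff half_gram_nth inner_commute)
  fix x
  have "x \<bullet> (half_gram X *v x) = ((x v* X) \<bullet> (x v* X)) / 2"
    by (simp add: half_gram_def scaleR_matrix_vector_assoc[symmetric] dot_lmul_matrix
        matrix_vector_mul_assoc[symmetric])
  then show "0 \<le> x \<bullet> (half_gram X *v x)" by (metis inner_ge_zero divide_nonneg_pos zero_less_numeral)
qed

lemma half_gram_of_columns:
  fixes f :: "'m::finite \<Rightarrow> real ^ 'n"
  shows "half_gram (\<chi> i j. sqrt 2 * f j $ i) = (\<Sum>j\<in>UNIV. outer (f j))"
  by (simp add: vec_eq_iff half_gram_nth inner_vec_def sum_divide_distrib field_simps)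

lemma outer_in_range_half_gram: "outer v \<in> range (half_gram :: real ^ 'm ^ 'n \<Rightarrow> _)"
proof -
  \<comment> \<open>One column carries \<open>v\<close>, all others vanish.\<close>
  define j0 :: 'm where "j0 = undefined"
  have "outer v = (\<Sum>j\<in>UNIV. if j = j0 then outer v else 0)" by simp
  also have "\<dots> = (\<Sum>j\<in>UNIV. outer (if j = j0 then v else 0))"
    by (intro sum.cong) (auto simp: vec_eq_iff)
  finally show ?thesis
    using half_gram_of_columns[of "\<lambda>j. if j = j0 then v else 0"] by (metis rangeI)
qed

lemma psd_mats_eq_convex_hull_range:
  "(psd_mats :: (real ^ 'n ^ 'n) set) = convex hull (range (half_gram :: real ^ 'm ^ 'n \<Rightarrow> _))"
proof (rule subset_antisym[OF subsetI])
  fix A :: "real ^ 'n ^ 'n" assume "A \<in> psd_mats"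
  then obtain v :: "'n \<Rightarrow> real ^ 'n" where v: "A = (\<Sum>k\<in>UNIV. outer (v k))"
    by (rule psd_as_sum_of_outer)
  \<comment> \<open>Scaling up by the number of terms turns the sum into an average.\<close>
  let ?N = "real CARD('n)"
  have eq: "A = (\<Sum>k\<in>UNIV. (1 / ?N) *\<^sub>R outer (sqrt ?N *\<^sub>R v k))"
    by (simp add: v outer_scaleR)
  show "A \<in> convex hull (range (half_gram :: real ^ 'm ^ 'n \<Rightarrow> _))"
    unfolding eq
    by (rule convex_sum) (auto intro: hull_inc outer_in_range_half_gram)
next
  show "convex hull (range (half_gram :: real ^ 'm ^ 'n \<Rightarrow> _)) \<subseteq> psd_mats"
    using closed_convex_cone_psd_mats
    by (intro hull_minimal) (auto simp: half_gram_psd closed_convex_cone_def)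
qed

lemma psd_mats_eq_range:
  assumes "CARD('m) = CARD('n)"
  shows "(psd_mats :: (real ^ 'n ^ 'n) set) = range (half_gram :: real ^ 'm ^ 'n \<Rightarrow> _)"
proof (rule subset_antisym[OF subsetI])
  fix A :: "real ^ 'n ^ 'n" assume "A \<in> psd_mats"
  then obtain v :: "'n \<Rightarrow> real ^ 'n" where v: "A = (\<Sum>k\<in>UNIV. outer (v k))"
    by (rule psd_as_sum_of_outer)
  from assms obtain h :: "'m \<Rightarrow> 'n" where "bij_betw h UNIV UNIV"
    using finite_same_card_bij[OF finite finite] by blast
  from sum.reindex_bij_betw[OF this, of "\<lambda>k. outer (v k)"]
  have "A = half_gram (\<chi> i j. sqrt 2 * v (h j) $ i)"
    by (simp add: v half_gram_of_columns)
  then show "A \<in> range (half_gram :: real ^ 'm ^ 'n \<Rightarrow> _)" by blast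
qed (auto simp: half_gram_psd)


section \<open>Convexity, closedness and the convex hull of the graph\<close>

lemma half_gram_convex_comb:
  assumes "u + v = 1"
  shows "u *\<^sub>R half_gram X + v *\<^sub>R half_gram Y
       = half_gram (u *\<^sub>R X + v *\<^sub>R Y) + (u * v) *\<^sub>R half_gram (X - Y)"
proof -
  have "u * (X $ i \<bullet> X $ j) + v * (Y $ i \<bullet> Y $ j)
      = (u *\<^sub>R X $ i + v *\<^sub>R Y $ i) \<bullet> (u *\<^sub>R X $ j + v *\<^sub>R Y $ j)
        + u * v * ((X $ i - Y $ i) \<bullet> (X $ j - Y $ j))" for i j
  proof -
    have u: "u = 1 - v" using assms by simp
    show ?thesis unfolding u
      by (simp add: inner_add_left inner_add_right inner_diff_left inner_diff_right algebra_simps)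
  qed
  then show ?thesis
    by (simp add: vec_eq_iff half_gram_nth flip: add_divide_distrib)
qed

lemma half_gram_midpoint:
  "(1 / 2) *\<^sub>R half_gram (X + Z) + (1 / 2) *\<^sub>R half_gram (X - Z) = half_gram X + half_gram Z"
proof -
  have "(1 / 2) *\<^sub>R (X + Z) + (1 / 2) *\<^sub>R (X - Z) = X"
    by (simp add: scaleR_add_right scaleR_diff_right flip: scaleR_add_left)
  moreover have "(X + Z) - (X - Z) = 2 *\<^sub>R Z"
    by (simp add: scaleR_2)
  ultimately show ?thesis
    using half_gram_convex_comb[of "1/2" "1/2" "X + Z" "X - Z"]
    by (simp add: half_gram_scaleR)
qed

lemma K_epi_half_gram:
  "K_epi UNIV sym_mats (half_gram :: real ^ 'm ^ 'n \<Rightarrow> _) psd_mats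
    = {(X, Y). Y - half_gram X \<in> psd_mats}"
proof -
  have "Y \<in> sym_mats" if "Y - half_gram X \<in> psd_mats" for X :: "real ^ 'm ^ 'n" and Y
    using subspace_add[OF subspace_sym_mats psd_mats_sym[OF that] psd_mats_sym[OF half_gram_psd[of X]]]
    by simp
  then show ?thesis by (auto simp: K_epi_def)
qed

lemma K_convex_half_gram: "K_convex UNIV sym_mats half_gram psd_mats"
  unfolding K_convex_def K_epi_half_gram
proof (rule convexI, clarsimp)
  fix X1 X2 :: "real ^ 'a ^ 'b" and Y1 Y2 and u v :: real
  assume *: "Y1 - half_gram X1 \<in> psd_mats" "Y2 - half_gram X2 \<in> psd_mats"
    and uv: "0 \<le> u" "0 \<le> v" "u + v = 1"
  have "u *\<^sub>R Y1 + v *\<^sub>R Y2 - half_gram (u *\<^sub>R X1 + v *\<^sub>R X2)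
      = u *\<^sub>R (Y1 - half_gram X1) + v *\<^sub>R (Y2 - half_gram X2)
        + (u * v) *\<^sub>R half_gram (X1 - X2)"
    using half_gram_convex_comb[OF uv(3), of X1 X2] by (simp add: algebra_simps)
  also have "\<dots> \<in> psd_mats"
    using * uv by (intro psd_mats_add psd_mats_scaleR half_gram_psd) auto
  finally show "u *\<^sub>R Y1 + v *\<^sub>R Y2 - half_gram (u *\<^sub>R X1 + v *\<^sub>R X2) \<in> psd_mats" .
qed

lemma continuous_on_half_gram: "continuous_on S half_gram"
proof -
  have eq: "half_gram = (\<lambda>X. \<chi> i j. (X $ i \<bullet> X $ j) / 2)"
    by (simp add: fun_eq_iff vec_eq_iff half_gram_nth)
  show ?thesis
    unfolding eq by (intro continuous_on_vec_lambda continuous_intros) simp_all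
qed

lemma closed_K_epi_half_gram: "closed (K_epi UNIV sym_mats half_gram psd_mats)"
proof -
  have "continuous_on UNIV (\<lambda>p. snd p - half_gram (fst p))"
    by (intro continuous_intros continuous_on_compose2[OF continuous_on_half_gram]) auto
  then have "closed ((\<lambda>p. snd p - half_gram (fst p)) -` psd_mats)"
    using closed_psd_mats closed_vimage by blast
  then show ?thesis
    unfolding K_epi_half_gram by (simp add: vimage_def split_def)
qed

text \<open>
  The midpoint of the graph points over \<open>X + Z\<close> and \<open>X - Z\<close> lies above \<open>X\<close> by exactly \<open>F(Z)\<close>;
  convex combinations over the fibre at \<open>X\<close> then give all of the cone.
\<close>

lemma convex_hull_gph_half_gram:
  "convex hull (gph UNIV (half_gram :: real ^ 'm ^ 'n \<Rightarrow> _))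
    = K_epi UNIV sym_mats half_gram psd_mats"
  (is "?H = ?E")
proof
  have "gph UNIV half_gram \<subseteq> ?E"
    by (auto simp: gph_def K_epi_half_gram zero_mem_psd_mats)
  then show "?H \<subseteq> ?E"
    using K_convex_half_gram unfolding K_convex_def by (rule hull_minimal)
next
  have "(X, half_gram X + P) \<in> ?H" if "P \<in> psd_mats" for X :: "real ^ 'm ^ 'n" and P
  proof -
    let ?C = "{P. (X, half_gram X + P) \<in> ?H}"
    have "half_gram Z \<in> ?C" for Z :: "real ^ 'm ^ 'n"
    proof -
      have "(1/2) *\<^sub>R (X + Z, half_gram (X + Z)) + (1/2) *\<^sub>R (X - Z, half_gram (X - Z)) \<in> ?H"
        by (intro convexD[OF convex_convex_hull] hull_inc) (auto simp: gph_def)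
      moreover have "(1/2) *\<^sub>R (X + Z) + (1/2) *\<^sub>R (X - Z) = X"
        by (simp add: scaleR_add_right scaleR_diff_right flip: scaleR_add_left)
      ultimately show ?thesis
        by (simp add: half_gram_midpoint)
    qed
    moreover have "convex ?C"
    proof (rule convexI, clarsimp)
      fix P Q and u v :: real
      assume *: "(X, half_gram X + P) \<in> ?H" "(X, half_gram X + Q) \<in> ?H"
        and uv: "0 \<le> u" "0 \<le> v" "u + v = 1"
      have "u *\<^sub>R (X, half_gram X + P) + v *\<^sub>R (X, half_gram X + Q) \<in> ?H"
        by (rule convexD[OF convex_convex_hull * uv])
      moreover have "u *\<^sub>R (X, half_gram X + P) + v *\<^sub>R (X, half_gram X + Q)
          = ((u + v) *\<^sub>R X, (u + v) *\<^sub>R half_gram X + (u *\<^sub>R P + v *\<^sub>R Q))"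
        by (simp add: algebra_simps)
      ultimately show "(X, half_gram X + (u *\<^sub>R P + v *\<^sub>R Q)) \<in> ?H"
        using uv(3) by simp
    qed
    ultimately have "convex hull (range (half_gram :: real ^ 'm ^ 'n \<Rightarrow> _)) \<subseteq> ?C"
      by (intro hull_minimal) auto
    then show ?thesis
      using that psd_mats_eq_convex_hull_range by blast
  qed
  from this[of "Y - half_gram X" X for X Y] show "?E \<subseteq> ?H"
    by (auto simp: K_epi_half_gram)
qed


section \<open>Minimality of the cone\<close>

lemma psd_mats_minimal:
  fixes F :: "real ^ 'm ^ 'n \<Rightarrow> real ^ 'n ^ 'n"
  assumes F: "F = half_gram" and K: "closed_convex_cone sym_mats K" "K_convex UNIV sym_mats F K"
  shows "psd_mats \<subseteq> K"
proof -
  have "F Z \<in> K" for Z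
  proof -
    \<comment> \<open>The midpoint of the graph points over \<open>Z\<close> and \<open>- Z\<close> is \<open>(0, F(Z))\<close>, and \<open>F(0) = 0\<close>.\<close>
    have "0 \<in> K"
      using K(1) by (metis closed_convex_cone_def cone_contains_0)
    then have "(Z, F Z) \<in> K_epi UNIV sym_mats F K" "(- Z, F (- Z)) \<in> K_epi UNIV sym_mats F K"
      by (simp_all add: K_epi_def F psd_mats_sym half_gram_psd)
    then have "(1/2) *\<^sub>R (Z, F Z) + (1/2) *\<^sub>R (- Z, F (- Z)) \<in> K_epi UNIV sym_mats F K"
      using K(2) unfolding K_convex_def by (intro convexD) auto
    then show ?thesis
      by (simp add: K_epi_def F flip: scaleR_add_left)
  qed
  then have "convex hull (range F) \<subseteq> K"
    using K(1) by (intro hull_minimal) (auto simp: closed_convex_cone_def)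
  then show ?thesis
    by (simp add: F flip: psd_mats_eq_convex_hull_range)
qed

theorem proposition49:
  fixes F :: "real ^ 'm ^ 'n \<Rightarrow> real ^ 'n ^ 'n"
  assumes "\<And>X. F X = (1 / 2) *\<^sub>R (X ** transpose X)"
  shows "((\<exists>K. is_K_F_hat UNIV sym_mats F K)
       \<and> K_F_hat UNIV sym_mats F = K_F UNIV sym_mats F
       \<and> K_F UNIV sym_mats F = psd_mats
       \<and> psd_mats = convex hull (range F)
       \<and> (CARD('m) = CARD('n) \<longrightarrow> psd_mats = range F))
    \<and> (K_closed UNIV sym_mats F psd_mats \<and> K_convex UNIV sym_mats F psd_mats)
    \<and> closure (convex hull (gph UNIV F)) = K_epi UNIV sym_mats F psd_mats"
proof -
  have F: "F = half_gram"
    using assms by (simp add: fun_eq_iff half_gram_def)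
  have conv: "K_convex UNIV sym_mats F psd_mats"
    unfolding F by (rule K_convex_half_gram)
  have clo: "K_closed UNIV sym_mats F psd_mats"
    unfolding K_closed_def F
    by (rule closed_subset[OF _ closed_K_epi_half_gram]) (auto simp: K_epi_def)
  have KF: "is_K_F UNIV sym_mats F psd_mats"
    using closed_convex_cone_psd_mats conv psd_mats_minimal[OF F]
    by (auto simp: is_K_F_def is_smallest_def)
  have KFh: "is_K_F_hat UNIV sym_mats F psd_mats"
    using closed_convex_cone_psd_mats conv clo psd_mats_minimal[OF F]
    by (auto simp: is_K_F_hat_def is_smallest_def)
  have gph: "closure (convex hull (gph UNIV F)) = K_epi UNIV sym_mats F psd_mats"
    unfolding F convex_hull_gph_half_gram
    by (rule closure_closed[OF closed_K_epi_half_gram])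
  have ran: "psd_mats = convex hull (range F)"
    unfolding F by (rule psd_mats_eq_convex_hull_range)
  have "CARD('m) = CARD('n) \<longrightarrow> psd_mats = range F"
    unfolding F using psd_mats_eq_range by blast
  then show ?thesis
    using KF KFh K_F_eqI[OF KF] K_F_hat_eqI[OF KFh] conv clo gph ran by auto
qed

end
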